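(* Let $\alpha,m,n$ be real numbers with $\alpha>0$, $m>0$ and $\alpha n+1>\bar{c}$, where $\bar{c}$ is the point of minimum of the gamma function $\Gamma(x)$ on $x>0$ (so $1<\bar{c}<2$). If $|z|<1$, then $$\left|E_{\alpha,m,n}(z)\right|\le\frac{1}{1-|z|}.$$
   Context: $\Gamma$ is Euler's gamma function. The generalized (Kilbas-type) Mittag-Leffler function is defined by $$E_{\alpha,m,n}(z)=1+\sum_{k=1}^{\infty}\left(\prod_{j=0}^{k-1}\frac{\Gamma(\alpha(jm+n)+1)}{\Gamma(\alpha(jm+n+1)+1)}\right)z^k,$$ where $z$ is a complex variable. *)

theory Defs
  imports "HOL-Analysis.Analysis"
begin

(* The series starts at k = 1 in the mathematics, hence the shift to Suc k.  The
   coefficients are meaningful only if no Gamma factor is evaluated at a pole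
   (where the library sets Gamma to 0); for alpha, m > 0 and alpha * n + 1 > 0
   all arguments are positive. *)

definition kilbas_coeff :: "real \<Rightarrow> real \<Rightarrow> real \<Rightarrow> nat \<Rightarrow> real" where
  "kilbas_coeff \<alpha> m n k =
     (\<Prod>j<k. Gamma (\<alpha> * (real j * m + n) + 1) / Gamma (\<alpha> * (real j * m + n + 1) + 1))"

definition kilbas_mittag_leffler :: "real \<Rightarrow> real \<Rightarrow> real \<Rightarrow> complex \<Rightarrow> complex" where
  "kilbas_mittag_leffler \<alpha> m n z =
     1 + (\<Sum>k. complex_of_real (kilbas_coeff \<alpha> m n (Suc k)) * z ^ Suc k)"

(* Gamma attains its minimum over the positive reals at exactly one point, so the
   choice operator in arg_min selects that point. *)

definition gamma_min_point :: real where
  "gamma_min_point = (ARG_MIN Gamma x. 0 < x)"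

end

theory Submission
  imports Defs
begin

text \<open>
  By log-convexity, \<open>Gamma\<close> is non-decreasing to the right of a point where it attains its minimum over
  the positive reals. Hence every factor of a coefficient, and so every coefficient, lies in
  \<open>[0, 1]\<close>, and the series is dominated by the geometric series of \<open>norm z\<close>.
\<close>

lemma ln_Gamma_convex:
  fixes x y t :: real
  assumes "x > 0" "y > 0" "0 \<le> t" "t \<le> 1"
  shows "ln (Gamma ((1 - t) * x + t * y)) \<le> (1 - t) * ln (Gamma x) + t * ln (Gamma y)"
  using convex_onD[OF log_convex_Gamma_real, of t x y] assms by simp

text \<open>Convexity of \<open>ln (Gamma x)\<close> in a form that starts from three ordered
  points. The strict bounds on \<open>t\<close> allow \<open>Gamma_ge_one_outside\<close> to cancel
  the factor \<open>t\<close> or \<open>1 - t\<close>.\<close>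

lemma ln_Gamma_le_of_between:
  fixes x y w :: real
  assumes "0 < x" "x < w" "w < y"
  obtains t where "0 < t" "t < 1" "ln (Gamma w) \<le> (1 - t) * ln (Gamma x) + t * ln (Gamma y)"
proof
  \<comment> \<open>The solution of \<open>(1 - t) * x + t * y = w\<close>.\<close>
  let ?t = "(w - x) / (y - x)"
  show t: "0 < ?t" "?t < 1"
    using assms by (auto simp: field_simps)
  have "?t * (y - x) = w - x"
    using assms by simp
  then have "(1 - ?t) * x + ?t * y = w"
    by (simp only: algebra_simps)
  then show "ln (Gamma w) \<le> (1 - ?t) * ln (Gamma x) + ?t * ln (Gamma y)"
    using ln_Gamma_convex[of x y ?t] assms t by simp
qed

text \<open>Since \<open>Gamma\<close> is 1 at both 1 and 2, the convex function
  \<open>ln (Gamma x)\<close> vanishes at these points and so cannot be negative outside the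
  interval between them. This confines the search for a minimum to a compact interval.\<close>

lemma Gamma_ge_one_outside:
  fixes x :: real
  assumes "0 < x" "x < 1 \<or> 2 < x"
  shows "1 \<le> Gamma x"
proof -
  have G2: "Gamma (2::real) = 1"
    using Gamma_fact[of 1, where 'a = real] by simp
  have "0 \<le> ln (Gamma x)"
    using assms(2)
  proof
    assume "x < 1"
    \<comment> \<open>Convexity with 1 as the middle point: the logarithms at 1 and 2 are both 0,
      which leaves only the term at \<open>x\<close>.\<close>
    then obtain t where "t < 1" "0 \<le> (1 - t) * ln (Gamma x)"
      using ln_Gamma_le_of_between[of x 1 2] assms(1) by (auto simp: G2)
    then show ?thesis by (simp add: zero_le_mult_iff)
  next
    assume "2 < x"
    then obtain t where "0 < t" "0 \<le> t * ln (Gamma x)"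
      using ln_Gamma_le_of_between[of 1 2 x] by (auto simp: G2)
    then show ?thesis by (simp add: zero_le_mult_iff)
  qed
  then show ?thesis
    using Gamma_real_pos[OF assms(1)] by simp
qed

text \<open>\<open>Gamma\<close> attains a minimum on [1, 2] by compactness, and it is global
  because \<open>Gamma 1 = 1\<close> is already a lower bound outside. Existence of such a point
  gives the choice operator its defining property.\<close>

lemma gamma_min_point:
  shows gamma_min_point_pos: "0 < gamma_min_point"
    and Gamma_gamma_min_point_le: "0 < x \<Longrightarrow> Gamma gamma_min_point \<le> Gamma x"
proof -
  have "continuous_on {1..2} (Gamma :: real \<Rightarrow> real)"
    by (intro continuous_on_Gamma continuous_on_id) (auto elim!: nonpos_Ints_cases)
  then obtain p where p: "p \<in> {1..2}" "\<And>y. y \<in> {1..2} \<Longrightarrow> Gamma p \<le> Gamma (y::real)"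
    using continuous_attains_inf[of "{1..2::real}" Gamma] by auto
  have "Gamma p \<le> Gamma y" if "0 < y" for y
  proof (cases "y \<in> {1..2}")
    case False
    then have "1 \<le> Gamma y"
      using that by (intro Gamma_ge_one_outside) auto
    then show ?thesis
      using p(2)[of 1] by simp
  qed (use p(2) in simp)
  then have "is_arg_min Gamma (\<lambda>x. 0 < x) p"
    using p(1) unfolding is_arg_min_def by (fastforce dest: leD)
  then have "is_arg_min Gamma (\<lambda>x. 0 < x) gamma_min_point"
    unfolding gamma_min_point_def arg_min_def by (rule someI)
  then show "0 < gamma_min_point" "0 < x \<Longrightarrow> Gamma gamma_min_point \<le> Gamma x"
    unfolding is_arg_min_def by (blast intro: leI)+
qed

text \<open>For \<open>x\<close> strictly between the minimum point and \<open>y\<close>, convexity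
  bounds \<open>ln (Gamma x)\<close> by a weighted mean of the values at these ends, of which the
  value at \<open>y\<close> is the larger.\<close>

lemma Gamma_mono_from_min:
  assumes "gamma_min_point < x" "x \<le> y"
  shows "Gamma x \<le> Gamma y"
proof (cases "x = y")
  case False
  have pos: "0 < x" "0 < y" "0 < gamma_min_point"
    using assms gamma_min_point_pos by auto
  obtain t where t: "0 < t" "t < 1"
    "ln (Gamma x) \<le> (1 - t) * ln (Gamma gamma_min_point) + t * ln (Gamma y)"
    using ln_Gamma_le_of_between[of gamma_min_point x y] assms False pos by auto
  have "ln (Gamma gamma_min_point) \<le> ln (Gamma y)"
    using Gamma_gamma_min_point_le[of y] pos by (simp add: Gamma_real_pos)
  then have "(1 - t) * ln (Gamma gamma_min_point) \<le> (1 - t) * ln (Gamma y)"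
    using t by (intro mult_left_mono) auto
  then have "ln (Gamma x) \<le> ln (Gamma y)"
    using t by (simp add: algebra_simps)
  then show ?thesis
    using pos by (simp add: Gamma_real_pos)
qed simp

text \<open>The term \<open>\<alpha> * (real j * m)\<close> is nonnegative, so every Gamma argument
  stays to the right of the minimum point. Each denominator's argument exceeds its numerator's by
  \<open>\<alpha>\<close>, so monotonicity puts every quotient in [0, 1].\<close>

lemma kilbas_coeff_bounds:
  assumes "\<alpha> > 0" "m > 0" "\<alpha> * n + 1 > gamma_min_point"
  shows "0 \<le> kilbas_coeff \<alpha> m n k" "kilbas_coeff \<alpha> m n k \<le> 1"
proof -
  have *: "0 < Gamma (\<alpha> * (real j * m + n) + 1)"
    "Gamma (\<alpha> * (real j * m + n) + 1) \<le> Gamma (\<alpha> * (real j * m + n + 1) + 1)" for j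
  proof -
    have "0 \<le> \<alpha> * (real j * m)"
      using assms by simp
    then have "gamma_min_point < \<alpha> * (real j * m + n) + 1"
      using assms(3) by (simp add: distrib_left)
    moreover have "\<alpha> * (real j * m + n) + 1 \<le> \<alpha> * (real j * m + n + 1) + 1"
      using assms(1) by simp
    ultimately show "0 < Gamma (\<alpha> * (real j * m + n) + 1)"
      "Gamma (\<alpha> * (real j * m + n) + 1) \<le> Gamma (\<alpha> * (real j * m + n + 1) + 1)"
      using gamma_min_point_pos by (auto intro!: Gamma_real_pos Gamma_mono_from_min)
  qed
  then have pos: "0 < Gamma (\<alpha> * (real j * m + n + 1) + 1)" for j
    by (meson less_le_trans)
  show "0 \<le> kilbas_coeff \<alpha> m n k"
    unfolding kilbas_coeff_def by (intro prod_nonneg ballI divide_nonneg_pos less_imp_le[OF *(1)] pos)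
  show "kilbas_coeff \<alpha> m n k \<le> 1"
    unfolding kilbas_coeff_def
    by (intro prod_le_1 conjI divide_nonneg_pos less_imp_le[OF *(1)] pos) (simp add: pos *)
qed

theorem lemma1:
  fixes \<alpha> m n :: real and z :: complex
  assumes "\<alpha> > 0" and "m > 0" and "\<alpha> * n + 1 > gamma_min_point"
    and "norm z < 1"
  shows "norm (kilbas_mittag_leffler \<alpha> m n z) \<le> 1 / (1 - norm z)"
proof -
  let ?a = "\<lambda>k. complex_of_real (kilbas_coeff \<alpha> m n (Suc k)) * z ^ Suc k"
  \<comment> \<open>The exponents start at 1; the missing term 1 of the geometric series returns as
    the leading 1 of \<open>kilbas_mittag_leffler\<close>.\<close>
  have geom: "(\<lambda>k. norm z ^ Suc k) sums (norm z / (1 - norm z))"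
    using sums_mult[OF geometric_sums[of "norm z"], of "norm z"] assms(4) by simp
  have "norm (?a k) \<le> norm z ^ Suc k" for k
    using kilbas_coeff_bounds[OF assms(1-3), of "Suc k"]
    by (simp only: norm_mult norm_power norm_of_real abs_of_nonneg mult_left_le_one_le norm_ge_zero zero_le_power)
  then have "norm (suminf ?a) \<le> norm z / (1 - norm z)"
    using norm_suminf_le[of ?a "\<lambda>k. norm z ^ Suc k"] geom by (auto simp: sums_iff)
  then have "norm (kilbas_mittag_leffler \<alpha> m n z) \<le> 1 + norm z / (1 - norm z)"
    unfolding kilbas_mittag_leffler_def by (intro norm_triangle_le) simp
  also have "\<dots> = 1 / (1 - norm z)"
    using assms(4) by (simp add: field_simps)
  finally show ?thesis .
qed

end
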